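(* Let $\mathbb{S}_1,\mathbb{S}_2,\mathbb{S}_3,\mathbb{S}_4$ be Borel subsets of Polish spaces, let $\Xi$ be a stochastic kernel on $\mathbb{S}_1\times\mathbb{S}_2$ given $\mathbb{S}_3\times\mathbb{S}_4$, and let $\Xi_{\int}$ be the stochastic kernel on $\mathbb{S}_1\times\mathbb{S}_2$ given $\mathbb{P}(\mathbb{S}_3)\times\mathbb{S}_4$ defined by $$\Xi_{\int}(A\times B|\mu,s_4):=\int_{\mathbb{S}_3}\Xi(A\times B|s_3,s_4)\,\mu(ds_3),\quad A\in\mathcal{B}(\mathbb{S}_1),\ B\in\mathcal{B}(\mathbb{S}_2),\ \mu\in\mathbb{P}(\mathbb{S}_3),\ s_4\in\mathbb{S}_4.$$ Then the stochastic kernel $\Xi_{\int}$ on $\mathbb{S}_1\times\mathbb{S}_2$ given $\mathbb{P}(\mathbb{S}_3)\times\mathbb{S}_4$ is semi-uniform Feller if and only if $\Xi$ on $\mathbb{S}_1\times\mathbb{S}_2$ given $\mathbb{S}_3\times\mathbb{S}_4$ is semi-uniform Feller.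
   Context: A Polish space is a complete separable metric space. Borel subsets of Polish spaces are considered as metric spaces with the restricted metric; products carry the product topology. $\mathcal{B}(\mathbb{S})$ is the Borel $\sigma$-field of a metric space $\mathbb{S}$. $\mathbb{P}(\mathbb{S})$ is the set of probability measures on $(\mathbb{S},\mathcal{B}(\mathbb{S}))$, endowed with the topology of weak convergence (which is metrizable when $\mathbb{S}$ is separable metric, e.g. by the Kantorovich–Rubinshtein metric). A stochastic kernel $\Psi$ on $\mathbb{S}_1\times\mathbb{S}_2$ given a metric space $\mathbb{T}$ is a mapping $\Psi:\mathcal{B}(\mathbb{S}_1\times\mathbb{S}_2)\times\mathbb{T}\to[0,1]$ such that $\Psi(\,\cdot\,|t)$ is a probability measure on $\mathbb{S}_1\times\mathbb{S}_2$ for every $t\in\mathbb{T}$, and $\Psi(D|\,\cdot\,)$ is Borel-measurable on $\mathbb{T}$ for every $D\in\mathcal{B}(\mathbb{S}_1\times\mathbb{S}_2)$. Write $\Psi(ds_1,B|t)$ for the finite measure $A\mapsto\Psi(A\times B|t)$ on $\mathbb{S}_1$. Such a kernel $\Psi$ is semi-uniform Feller if, for each sequence $t^{(n)}\to t$ in $\mathbb{T}$ and each bounded continuous function $f$ on $\mathbb{S}_1$, $$\lim_{n\to\infty}\sup_{B\in\mathcal{B}(\mathbb{S}_2)}\left|\int_{\mathbb{S}_1}f(s_1)\,\Psi(ds_1,B|t^{(n)})-\int_{\mathbb{S}_1}f(s_1)\,\Psi(ds_1,B|t)\right|=0.$$ *)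

theory Defs
  imports "HOL-Probability.Probability"
begin

abbreviation borel_on :: "'a::topological_space set \<Rightarrow> 'a measure" where
  "borel_on S \<equiv> restrict_space borel S"

definition borel_of :: "'t topology \<Rightarrow> 't measure" where
  "borel_of T = sigma (topspace T) {U. openin T U}"

text \<open>
  The topology of weak convergence on the set of Borel probability measures on \<open>S\<close>: the coarsest
  topology for which all integration maps of bounded continuous functions are continuous.
\<close>

definition weak_topology :: "'a::topological_space set \<Rightarrow> 'a measure topology" where
  "weak_topology S = topology_generated_by
     {{\<mu> \<in> space (prob_algebra (borel_on S)). (\<integral>x. f x \<partial>\<mu>) \<in> U} | f U.
        continuous_on S f \<and> bounded (f ` S) \<and> open (U :: real set)}"

definition stochastic_kernel ::
  "'a::topological_space set \<Rightarrow> 'b::topological_space set \<Rightarrow> 't topology \<Rightarrow>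
     ('t \<Rightarrow> ('a \<times> 'b) measure) \<Rightarrow> bool" where
  "stochastic_kernel S1 S2 T \<Psi> \<longleftrightarrow>
     (\<forall>t \<in> topspace T. prob_space (\<Psi> t) \<and> sets (\<Psi> t) = sets (borel_on (S1 \<times> S2))) \<and>
     (\<forall>D \<in> sets (borel_on (S1 \<times> S2)). (\<lambda>t. measure (\<Psi> t) D) \<in> borel_measurable (borel_of T))"

text \<open>The finite measure \<open>A \<mapsto> \<Phi> (A \<times> B)\<close> on \<open>S1\<close>.\<close>

definition slice_measure ::
  "'a::topological_space set \<Rightarrow> ('a \<times> 'b) measure \<Rightarrow> 'b set \<Rightarrow> 'a measure" where
  "slice_measure S1 \<Phi> B = measure_of S1 (sets (borel_on S1)) (\<lambda>A. emeasure \<Phi> (A \<times> B))"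

text \<open>
  The supremum is taken in the reals; for a stochastic kernel the set in question is nonempty and
  bounded by twice the supremum of \<open>\<bar>f\<bar>\<close> on \<open>S1\<close>. The conditioning space is given as a topology;
  it is metrizable in all uses, so that sequences suffice.
\<close>

definition semi_uniform_feller ::
  "'a::topological_space set \<Rightarrow> 'b::topological_space set \<Rightarrow> 't topology \<Rightarrow>
     ('t \<Rightarrow> ('a \<times> 'b) measure) \<Rightarrow> bool" where
  "semi_uniform_feller S1 S2 T \<Psi> \<longleftrightarrow>
     (\<forall>\<tau> t. (\<forall>n. \<tau> n \<in> topspace T) \<longrightarrow> limitin T \<tau> t sequentially \<longrightarrow>
       (\<forall>f :: 'a \<Rightarrow> real. continuous_on S1 f \<longrightarrow> bounded (f ` S1) \<longrightarrow>
         (\<lambda>n. SUP B \<in> sets (borel_on S2).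
            \<bar>(\<integral>s. f s \<partial>slice_measure S1 (\<Psi> (\<tau> n)) B) - (\<integral>s. f s \<partial>slice_measure S1 (\<Psi> t) B)\<bar>)
         \<longlonglongrightarrow> 0))"

lemma topspace_weak_topology [simp]:
  "topspace (weak_topology S) = space (prob_algebra (borel_on S))"
proof -
  have "space (prob_algebra (borel_on S)) \<in>
     {{\<mu> \<in> space (prob_algebra (borel_on S)). (\<integral>x. f x \<partial>\<mu>) \<in> U} | f U.
        continuous_on S f \<and> bounded (f ` S) \<and> open (U :: real set)}"
    by (intro CollectI exI[of _ "\<lambda>_. 0"] exI[of _ UNIV]) (auto simp: bounded_iff)
  then show ?thesis
    unfolding weak_topology_def topology_generated_by_topspace by blast
qed

lemma continuous_map_integral_weak_topology:
  fixes f :: "'a::topological_space \<Rightarrow> real"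
  assumes "continuous_on S f" "bounded (f ` S)"
  shows "continuous_map (weak_topology S) euclidean (\<lambda>\<mu>. \<integral>x. f x \<partial>\<mu>)"
  unfolding continuous_map_def
proof (intro conjI allI impI)
  fix U :: "real set" assume "openin euclidean U"
  then show "openin (weak_topology S) {\<mu> \<in> topspace (weak_topology S). (\<integral>x. f x \<partial>\<mu>) \<in> U}"
    unfolding topspace_weak_topology
    using assms by (auto simp: weak_topology_def intro!: topology_generated_by_Basis)
qed auto

lemma space_borel_of [simp]: "space (borel_of T) = topspace T"
  by (simp add: borel_of_def space_measure_of_conv)

lemma sets_borel_of: "sets (borel_of T) = sigma_sets (topspace T) {U. openin T U}"
  unfolding borel_of_def by (rule sets_measure_of) (auto dest: openin_subset)

lemma measurable_borel_of:
  assumes "continuous_map T T' g"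
  shows "g \<in> borel_of T \<rightarrow>\<^sub>M borel_of T'"
proof (rule measurable_sigma_sets[OF sets_borel_of])
  fix U assume "U \<in> {U. openin T' U}"
  then have "openin T {x \<in> topspace T. g x \<in> U}"
    using assms by (auto simp: continuous_map_def)
  moreover have "g -` U \<inter> space (borel_of T) = {x \<in> topspace T. g x \<in> U}" by auto
  ultimately show "g -` U \<inter> space (borel_of T) \<in> sets (borel_of T)"
    unfolding sets_borel_of by auto
qed (use assms in \<open>auto simp: continuous_map_def dest: openin_subset\<close>)

lemma sets_borel_of_top_of_set:
  assumes "S \<in> sets borel"
  shows "sets (borel_of (top_of_set S)) = sets (borel_on S)"
proof -
  have "sets (borel_on S) = sigma_sets S ((\<lambda>A. S \<inter> A) ` {U. open U})"
    unfolding sets_restrict_space borel_def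
    by (subst sets_measure_of, simp, subst sigma_sets_Int[symmetric])
       (use assms in \<open>auto simp: borel_def\<close>)
  also have "(\<lambda>A. S \<inter> A) ` {U. open U} = {U. openin (top_of_set S) U}"
    by (auto simp: openin_open)
  finally show ?thesis by (simp add: sets_borel_of)
qed

lemma measurable_weak_topology_prob_algebra:
  fixes S :: "'a::metric_space set"
  assumes "S \<in> sets borel"
  shows "(\<lambda>\<mu>. \<mu>) \<in> borel_of (weak_topology S) \<rightarrow>\<^sub>M prob_algebra (borel_on S)"
proof (rule measurable_prob_algebra_generated)
  show "sets (borel_on S) = sigma_sets S ((\<inter>) S ` Collect closed)"
    unfolding sets_restrict_space borel_eq_closed
    by (subst sets_measure_of, simp, subst sigma_sets_Int)
       (use assms in \<open>auto simp: borel_eq_closed\<close>)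
  show "Int_stable ((\<inter>) S ` Collect closed)"
  proof (rule Int_stableI)
    fix A B assume "A \<in> (\<inter>) S ` Collect closed" "B \<in> (\<inter>) S ` Collect closed"
    then obtain C D where "closed C" "closed D" "A = S \<inter> C" "B = S \<inter> D" by auto
    then show "A \<inter> B \<in> (\<inter>) S ` Collect closed"
      by (intro image_eqI[where x="C \<inter> D"]) auto
  qed
  fix A assume "A \<in> (\<inter>) S ` Collect closed"
  then obtain C where C: "closed C" "A = S \<inter> C" by auto
  show "(\<lambda>\<mu>. emeasure \<mu> A) \<in> borel_measurable (borel_of (weak_topology S))"
  proof (cases "C = {}")
    case True
    then show ?thesis using C by simp
  next
    case False
    define f where "f n x = max 0 (1 - real n * infdist x C)" for n x
    have cont: "continuous_on X (f n)" for X n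
      unfolding f_def by (intro continuous_intros)
    have bnd: "\<bar>f n x\<bar> \<le> 1" for n x
      unfolding f_def using infdist_nonneg[of x C] by (auto simp: max_def)
    have lim: "(\<lambda>n. f n x) \<longlonglongrightarrow> indicator C x" for x
    proof (cases "x \<in> C")
      case True
      then show ?thesis by (simp add: f_def)
    next
      case x: False
      then have pos: "infdist x C > 0"
        using C False by (meson infdist_pos_not_in_closed)
      have "\<forall>\<^sub>F n in sequentially. f n x = 0"
        using eventually_ge_at_top[of "nat \<lceil>1 / infdist x C\<rceil>"]
      proof eventually_elim
        case (elim n)
        then have "1 / infdist x C \<le> real n" by linarith
        then show ?case using pos by (simp add: f_def field_simps)
      qed
      then show ?thesis using x by (simp add: tendsto_eventually)
    qed
    have meas: "(\<lambda>\<mu>. measure \<mu> A) \<in> borel_measurable (borel_of (weak_topology S))"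
    proof (rule borel_measurable_LIMSEQ_real)
      fix n
      have "continuous_map (weak_topology S) euclidean (\<lambda>\<mu>. \<integral>x. f n x \<partial>\<mu>)"
        using cont bnd by (intro continuous_map_integral_weak_topology) (auto intro!: boundedI[where B=1])
      from measurable_borel_of[OF this]
      show "(\<lambda>\<mu>. \<integral>x. f n x \<partial>\<mu>) \<in> borel_measurable (borel_of (weak_topology S))"
        using sets_borel_of_top_of_set[of "UNIV :: real set"]
        by (simp cong: measurable_cong_sets)
    next
      fix \<mu> assume "\<mu> \<in> space (borel_of (weak_topology S))"
      then have \<mu>: "sets \<mu> = sets (borel_on S)" "prob_space \<mu>"
        by (auto simp: space_prob_algebra)
      interpret prob_space \<mu> by fact
      have sp: "space \<mu> = S"
        using sets_eq_imp_space_eq[OF \<mu>(1)] by (simp add: space_restrict_space)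
      have mb: "g \<in> borel_measurable \<mu>" if "g \<in> borel_measurable borel" for g :: "'a \<Rightarrow> real"
        using measurable_restrict_space1[OF that, of S] \<mu>(1) by (simp cong: measurable_cong_sets)
      have "(\<lambda>n. \<integral>x. f n x \<partial>\<mu>) \<longlonglongrightarrow> (\<integral>x. indicator C x \<partial>\<mu>)"
      proof (rule integral_dominated_convergence[where w="\<lambda>_. 1"])
        show "(indicator C :: 'a \<Rightarrow> real) \<in> borel_measurable \<mu>"
          using C by (intro mb borel_measurable_indicator) simp
        show "f n \<in> borel_measurable \<mu>" for n
          by (intro mb borel_measurable_continuous_onI cont)
      qed (use lim bnd in auto)
      then show "(\<lambda>n. \<integral>x. f n x \<partial>\<mu>) \<longlonglongrightarrow> measure \<mu> A"
        using sp C by (simp add: Int_commute)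
    qed
    show ?thesis
      by (subst measurable_cong[where g="\<lambda>\<mu>. ennreal (measure \<mu> A)"])
         (use meas in \<open>auto simp: space_prob_algebra finite_measure.emeasure_eq_measure prob_space_def\<close>)
  qed
qed (auto simp: space_prob_algebra)

lemma measurable_stochastic_kernel:
  assumes "stochastic_kernel S1 S2 T \<Psi>"
  shows "\<Psi> \<in> borel_of T \<rightarrow>\<^sub>M prob_algebra (borel_on (S1 \<times> S2))"
proof (intro measurable_prob_algebraI measurable_subprob_algebra)
  fix D assume "D \<in> sets (borel_on (S1 \<times> S2))"
  then have "(\<lambda>t. measure (\<Psi> t) D) \<in> borel_measurable (borel_of T)"
    using assms by (auto simp: stochastic_kernel_def)
  then show "(\<lambda>t. emeasure (\<Psi> t) D) \<in> borel_measurable (borel_of T)"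
    by (subst measurable_cong[where g="\<lambda>t. ennreal (measure (\<Psi> t) D)"])
       (use assms in \<open>auto simp: stochastic_kernel_def finite_measure.emeasure_eq_measure prob_space_def\<close>)
qed (use assms in \<open>auto simp: stochastic_kernel_def prob_space_imp_subprob_space\<close>)

text \<open>
  Integrating out the first conditioning variable of a stochastic kernel always yields a stochastic
  kernel, whose values on rectangles are the integrals of those of the given kernel.
\<close>

lemma stochastic_kernel_mixture:
  fixes S1 :: "'a::polish_space set" and S2 :: "'b::polish_space set"
    and S3 :: "'c::polish_space set" and S4 :: "'d::polish_space set"
  assumes S: "S1 \<in> sets borel" "S2 \<in> sets borel" "S3 \<in> sets borel" "S4 \<in> sets borel"
    and \<Xi>: "stochastic_kernel S1 S2 (prod_topology (top_of_set S3) (top_of_set S4)) \<Xi>"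
  defines "\<Xi>int \<equiv> \<lambda>(\<mu>, s4). \<mu> \<bind> (\<lambda>s3. \<Xi> (s3, s4))"
  shows "stochastic_kernel S1 S2 (prod_topology (weak_topology S3) (top_of_set S4)) \<Xi>int"
    and "\<And>A B \<mu> s4. A \<in> sets (borel_on S1) \<Longrightarrow> B \<in> sets (borel_on S2) \<Longrightarrow>
           \<mu> \<in> space (prob_algebra (borel_on S3)) \<Longrightarrow> s4 \<in> S4 \<Longrightarrow>
           measure (\<Xi>int (\<mu>, s4)) (A \<times> B) = (\<integral>s3. measure (\<Xi> (s3, s4)) (A \<times> B) \<partial>\<mu>)"
proof -
  let ?W = "borel_of (prod_topology (weak_topology S3) (top_of_set S4))"
  have top: "prod_topology (top_of_set S3) (top_of_set S4) = top_of_set (S3 \<times> S4)"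
    by (simp add: subtopology_Times flip: euclidean_product_topology)
  have "\<Xi> \<in> borel_on (S3 \<times> S4) \<rightarrow>\<^sub>M prob_algebra (borel_on (S1 \<times> S2))"
    using measurable_stochastic_kernel[OF \<Xi>]
      sets_borel_of_top_of_set[OF borel_Times[OF S(3,4)]]
    by (simp add: top cong: measurable_cong_sets)
  moreover have "(\<lambda>x. x) \<in> borel_on S3 \<Otimes>\<^sub>M borel_on S4 \<rightarrow>\<^sub>M borel_on (S3 \<times> S4)"
  proof (rule measurable_restrict_space2)
    have "fst \<in> borel_on S3 \<Otimes>\<^sub>M borel_on S4 \<rightarrow>\<^sub>M (borel :: 'c measure)"
      by (rule measurable_compose[OF measurable_fst]) (simp add: measurable_restrict_space1)
    moreover have "snd \<in> borel_on S3 \<Otimes>\<^sub>M borel_on S4 \<rightarrow>\<^sub>M (borel :: 'd measure)"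
      by (rule measurable_compose[OF measurable_snd]) (simp add: measurable_restrict_space1)
    ultimately have "(\<lambda>x. (fst x, snd x)) \<in> borel_on S3 \<Otimes>\<^sub>M borel_on S4 \<rightarrow>\<^sub>M (borel :: ('c \<times> 'd) measure)"
      by (rule borel_measurable_Pair)
    then show "(\<lambda>x. x) \<in> borel_on S3 \<Otimes>\<^sub>M borel_on S4 \<rightarrow>\<^sub>M (borel :: ('c \<times> 'd) measure)"
      by simp
  qed (auto simp: space_pair_measure space_restrict_space)
  ultimately have \<Xi>_pair [measurable]:
    "\<Xi> \<in> borel_on S3 \<Otimes>\<^sub>M borel_on S4 \<rightarrow>\<^sub>M prob_algebra (borel_on (S1 \<times> S2))"
    by (rule measurable_compose[rotated])
  have [measurable]: "fst \<in> ?W \<rightarrow>\<^sub>M prob_algebra (borel_on S3)"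
    by (rule measurable_compose[OF measurable_borel_of[OF continuous_map_fst]
          measurable_weak_topology_prob_algebra[OF S(3)]])
  have [measurable]: "snd \<in> ?W \<rightarrow>\<^sub>M borel_on S4"
    using measurable_borel_of[OF continuous_map_snd[of "weak_topology S3" "top_of_set S4"]]
      sets_borel_of_top_of_set[OF S(4)] by (simp cong: measurable_cong_sets)
  have eq: "\<Xi>int = (\<lambda>x. fst x \<bind> (\<lambda>s3. \<Xi> (s3, snd x)))"
    by (auto simp: \<Xi>int_def)
  have meas: "\<Xi>int \<in> ?W \<rightarrow>\<^sub>M prob_algebra (borel_on (S1 \<times> S2))"
    unfolding eq by measurable
  then show "stochastic_kernel S1 S2 (prod_topology (weak_topology S3) (top_of_set S4)) \<Xi>int"
    unfolding stochastic_kernel_def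
    using measurable_space[OF meas] measurable_compose[OF meas measurable_measure_prob_algebra]
    by (auto simp: space_prob_algebra)
  fix A B \<mu> s4
  assume AB: "A \<in> sets (borel_on S1)" "B \<in> sets (borel_on S2)"
    and \<mu>: "\<mu> \<in> space (prob_algebra (borel_on S3))" and s4: "s4 \<in> S4"
  have D: "A \<times> B \<in> sets (borel_on (S1 \<times> S2))"
    using AB S by (auto simp: sets_restrict_space_iff borel_Times)
  have [measurable]: "s4 \<in> space (borel_on S4)"
    using s4 by (simp add: space_restrict_space)
  have K: "(\<lambda>s3. \<Xi> (s3, s4)) \<in> borel_on S3 \<rightarrow>\<^sub>M subprob_algebra (borel_on (S1 \<times> S2))"
    by (rule measurable_prob_algebraD) measurable
  have sets: "sets \<mu> = sets (borel_on S3)" and "prob_space \<mu>"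
    using \<mu> by (auto simp: space_prob_algebra)
  interpret prob_space \<mu> by fact
  have "measure (\<mu> \<bind> (\<lambda>s3. \<Xi> (s3, s4))) (A \<times> B) = (\<integral>s3. measure (\<Xi> (s3, s4)) (A \<times> B) \<partial>\<mu>)"
    using K sets D by (intro measure_bind) (simp_all cong: measurable_cong_sets)
  then show "measure (\<Xi>int (\<mu>, s4)) (A \<times> B) = (\<integral>s3. measure (\<Xi> (s3, s4)) (A \<times> B) \<partial>\<mu>)"
    by (simp add: \<Xi>int_def)
qed

lemma emeasure_slice_measure:
  assumes "S1 \<in> sets borel" "S2 \<in> sets borel"
    and \<Phi>: "sets \<Phi> = sets (borel_on (S1 \<times> S2))"
    and A: "A \<in> sets (borel_on S1)" and B: "B \<in> sets (borel_on S2)"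
  shows "emeasure (slice_measure S1 \<Phi> B) A = emeasure \<Phi> (A \<times> B)"
proof -
  have rect: "A' \<times> B \<in> sets \<Phi>" if "A' \<in> sets (borel_on S1)" for A'
    using assms that by (auto simp: sets_restrict_space_iff borel_Times)
  show ?thesis
    unfolding slice_measure_def
  proof (rule emeasure_measure_of_sigma[OF _ _ _ A])
    show "sigma_algebra S1 (sets (borel_on S1))"
      using sets.sigma_algebra_axioms[of "borel_on S1"] by (simp add: space_restrict_space)
    show "countably_additive (sets (borel_on S1)) (\<lambda>A. emeasure \<Phi> (A \<times> B))"
    proof (rule countably_additiveI)
      fix F :: "nat \<Rightarrow> _" assume F: "range F \<subseteq> sets (borel_on S1)" "disjoint_family F"
      have "(\<Sum>i. emeasure \<Phi> (F i \<times> B)) = emeasure \<Phi> (\<Union>i. F i \<times> B)"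
        using F by (intro suminf_emeasure) (auto intro!: rect simp: disjoint_family_on_def)
      also have "(\<Union>i. F i \<times> B) = (\<Union>i. F i) \<times> B" by auto
      finally show "(\<Sum>i. emeasure \<Phi> (F i \<times> B)) = emeasure \<Phi> ((\<Union>i. F i) \<times> B)" .
    qed
  qed (simp add: positive_def)
qed

end

theory Submission
  imports Defs
begin

text \<open>
  Dirac measures embed \<open>S3\<close> continuously into the probability measures on \<open>S3\<close>, and \<open>\<Xi>int\<close> restricts
  to \<open>\<Xi>\<close> along this embedding; this gives one direction. For the other, the semi-uniform Feller
  property of \<open>\<Xi>\<close> says that the functions \<open>(s3, s4) \<mapsto> \<integral> f(s1) \<Xi>(ds1, B | s3, s4)\<close>, indexed by the Borel
  sets \<open>B\<close>, are equicontinuous at each point. Such a uniformly bounded family is integrated, up to a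
  small error independent of \<open>B\<close>, by finitely many functions of a countable continuous partition
  subordinate to balls of small oscillation. These finitely many integrals converge under weak
  convergence, and they also control the mass on which the finite partition does not sum to \<open>1\<close>.
\<close>

section \<open>Uniform convergence of integrals of equicontinuous families\<close>

lemma measurable_borel_on_if_borel:
  assumes "f \<in> borel_measurable borel" "sets M = sets (borel_on S)"
  shows "f \<in> borel_measurable M"
  using measurable_restrict_space1[OF assms(1), of S] assms(2) by (simp cong: measurable_cong_sets)

text \<open>With \<open>H\<close> the sum of the \<open>h j\<close>, the pointwise difference is
  \<open>g * (1 - H)\<close> plus the sum of \<open>(g - c j) * h j\<close>. The first term is at
  most \<open>M * (1 - H)\<close>, the second at most \<open>e\<close> because \<open>g\<close> is
  close to \<open>c j\<close> wherever \<open>h j\<close> is nonzero; integration gives the bound.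
  The \<open>c j\<close> are free numbers, so that functions varying with \<open>n\<close> can share
  the coefficients of their limit.\<close>

lemma integral_partition_approx:
  fixes g :: "'c::topological_space \<Rightarrow> real" and h :: "nat \<Rightarrow> 'c \<Rightarrow> real"
  assumes "prob_space \<nu>" and sets: "sets \<nu> = sets (borel_on S)"
    and g: "g \<in> borel_measurable \<nu>" and gM: "\<And>y. y \<in> S \<Longrightarrow> \<bar>g y\<bar> \<le> M"
    and h: "\<And>j. continuous_on UNIV (h j)" and h_nonneg: "\<And>j y. 0 \<le> h j y"
    and h_sum: "\<And>y. (\<Sum>j<N. h j y) \<le> 1"
    and osc: "\<And>j y. j < N \<Longrightarrow> y \<in> S \<Longrightarrow> h j y \<noteq> 0 \<Longrightarrow> \<bar>g y - c j\<bar> \<le> e"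
    and e: "0 \<le> e"
  shows "\<bar>(\<integral>y. g y \<partial>\<nu>) - (\<Sum>j<N. c j * (\<integral>y. h j y \<partial>\<nu>))\<bar> \<le> e + M * (1 - (\<Sum>j<N. \<integral>y. h j y \<partial>\<nu>))"
proof -
  interpret prob_space \<nu> by fact
  have sp: "space \<nu> = S"
    using sets_eq_imp_space_eq[OF sets] by (simp add: space_restrict_space)
  have h_le: "h j y \<le> 1" if "j < N" for j y
    using member_le_sum[of j "{..<N}" "\<lambda>j. h j y"] that h_nonneg h_sum[of y] by (simp add: order_trans)
  have int_h: "integrable \<nu> (h j)" if "j < N" for j
    using h_nonneg h_le[OF that]
    by (intro integrable_const_bound[where B=1] measurable_borel_on_if_borel[OF _ sets]
          borel_measurable_continuous_onI h) auto
  have int_g: "integrable \<nu> g"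
    using gM by (intro integrable_const_bound[where B=M] g) (auto simp: sp)
  have int_sum: "integrable \<nu> (\<lambda>y. \<Sum>j<N. c j * h j y)"
    using int_h by (intro Bochner_Integration.integrable_sum integrable_mult_right) simp
  have int_H: "integrable \<nu> (\<lambda>y. \<Sum>j<N. h j y)"
    using int_h by (intro Bochner_Integration.integrable_sum) simp
  have pointwise: "\<bar>g y - (\<Sum>j<N. c j * h j y)\<bar> \<le> e + M * (1 - (\<Sum>j<N. h j y))" if y: "y \<in> S" for y
  proof -
    let ?H = "\<Sum>j<N. h j y"
    have "g y - (\<Sum>j<N. c j * h j y) = g y * (1 - ?H) + (\<Sum>j<N. (g y - c j) * h j y)"
      by (simp add: left_diff_distrib right_diff_distrib sum_subtractf sum_distrib_left)
    also have "\<bar>\<dots>\<bar> \<le> \<bar>g y * (1 - ?H)\<bar> + \<bar>\<Sum>j<N. (g y - c j) * h j y\<bar>"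
      by (rule abs_triangle_ineq)
    also have "\<bar>g y * (1 - ?H)\<bar> \<le> M * (1 - ?H)"
      using gM[OF y] h_sum[of y] by (simp add: abs_mult mult_right_mono)
    also have "\<bar>\<Sum>j<N. (g y - c j) * h j y\<bar> \<le> (\<Sum>j<N. e * h j y)"
    proof (rule order_trans[OF sum_abs sum_mono])
      fix j assume "j \<in> {..<N}"
      then show "\<bar>(g y - c j) * h j y\<bar> \<le> e * h j y"
        using osc[of j y] y h_nonneg[of j y]
        by (cases "h j y = 0") (auto simp: abs_mult intro: mult_right_mono)
    qed
    also have "\<dots> \<le> e"
      using h_sum[of y] e by (simp add: sum_distrib_left[symmetric] mult_left_le)
    finally show ?thesis by simp
  qed
  have "(\<integral>y. g y \<partial>\<nu>) - (\<Sum>j<N. c j * (\<integral>y. h j y \<partial>\<nu>)) = (\<integral>y. g y - (\<Sum>j<N. c j * h j y) \<partial>\<nu>)"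
    using int_g int_sum int_h by simp
  also have "\<bar>\<dots>\<bar> \<le> (\<integral>y. \<bar>g y - (\<Sum>j<N. c j * h j y)\<bar> \<partial>\<nu>)"
    by (rule integral_abs_bound)
  also have "\<dots> \<le> (\<integral>y. e + M * (1 - (\<Sum>j<N. h j y)) \<partial>\<nu>)"
    using int_g int_sum int_H pointwise by (intro integral_mono) (auto simp: sp)
  also have "\<dots> = e + M * (1 - (\<Sum>j<N. \<integral>y. h j y \<partial>\<nu>))"
    using int_H int_h by (simp add: prob_space)
  finally show ?thesis .
qed

text \<open>The Lindelof property selects countably many of the balls. Their centres form a nonempty
  countable set, hence the range of a sequence, possibly with repetitions; indexing by naturals is
  what the partial sums of the partition require.\<close>

lemma countable_ball_cover:
  fixes S :: "'c::{metric_space, second_countable_topology} set"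
  assumes "S \<noteq> {}" and r: "\<And>x. x \<in> S \<Longrightarrow> 0 < r x"
  obtains x :: "nat \<Rightarrow> 'c" where "\<And>i. x i \<in> S" "S \<subseteq> (\<Union>i. ball (x i) (r (x i)))"
proof -
  obtain \<F> where \<F>: "\<F> \<subseteq> (\<lambda>x. ball x (r x)) ` S" "countable \<F>" "\<Union>\<F> = (\<Union>x\<in>S. ball x (r x))"
    by (rule Lindelof_openin[of "(\<lambda>x. ball x (r x)) ` S" UNIV]) auto
  then obtain C where C: "countable C" "C \<subseteq> S" "\<F> = (\<lambda>x. ball x (r x)) ` C"
    using countable_subset_image[of \<F> "\<lambda>x. ball x (r x)" S] by blast
  have cover: "S \<subseteq> (\<Union>x\<in>C. ball x (r x))"
    using \<F>(3) C(3) r by fastforce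
  then have "C \<noteq> {}" using assms(1) by auto
  then have "range (from_nat_into C) = C"
    using C(1) by (rule range_from_nat_into)
  then have "from_nat_into C i \<in> S" for i
    using C(2) by blast
  moreover have "S \<subseteq> (\<Union>i. ball (from_nat_into C i) (r (from_nat_into C i)))"
    using cover by (subst (asm) \<open>range (from_nat_into C) = C\<close>[symmetric]) simp
  ultimately show thesis by (rule that)
qed

text \<open>
  The summands \<open>h N j\<close> arise by telescoping the truncations \<open>min 1 (N * (\<phi> 0 + \<dots> + \<phi> (j - 1)))\<close> of the
  partial sums of tent functions \<open>\<phi> i\<close> supported on the balls.
\<close>

lemma continuous_partition:
  fixes x :: "nat \<Rightarrow> 'c::metric_space"
  assumes cover: "S \<subseteq> (\<Union>i. ball (x i) (r i))"
  obtains h :: "nat \<Rightarrow> nat \<Rightarrow> 'c \<Rightarrow> real" where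
    "\<And>N j. continuous_on UNIV (h N j)" "\<And>N j y. 0 \<le> h N j y" "\<And>N y. (\<Sum>j<N. h N j y) \<le> 1"
    "\<And>N j y. h N j y \<noteq> 0 \<Longrightarrow> dist (x j) y < r j"
    "\<And>y. y \<in> S \<Longrightarrow> (\<lambda>N. \<Sum>j<N. h N j y) \<longlonglongrightarrow> 1"
proof
  define \<phi> where "\<phi> i y = max 0 (r i - dist (x i) y)" for i y
  define s where "s N j y = min 1 (real N * (\<Sum>i<j. \<phi> i y))" for N j :: nat and y
  define h where "h N j y = s N (Suc j) y - s N j y" for N j y
  have \<phi>_nonneg: "0 \<le> \<phi> i y" for i y by (simp add: \<phi>_def)
  have sum_h: "(\<Sum>j<N. h N j y) = s N N y" for N y
    unfolding h_def by (subst sum_lessThan_telescope) (simp add: s_def)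
  show "continuous_on UNIV (h N j)" for N j
    unfolding h_def s_def \<phi>_def by (intro continuous_intros)
  show "0 \<le> h N j y" for N j y
  proof -
    have "s N j y \<le> s N (Suc j) y"
      unfolding s_def using \<phi>_nonneg[of j y] by (intro min.mono mult_left_mono) auto
    then show ?thesis by (simp add: h_def)
  qed
  show "(\<Sum>j<N. h N j y) \<le> 1" for N y
    unfolding sum_h by (simp add: s_def)
  \<comment> \<open>Where \<open>\<phi> j y\<close> vanishes, the two truncations whose difference
    is \<open>h N j y\<close> coincide.\<close>
  show "dist (x j) y < r j" if "h N j y \<noteq> 0" for N j y
    using that by (cases "\<phi> j y = 0") (auto simp: h_def s_def \<phi>_def max_def split: if_splits)
  show "(\<lambda>N. \<Sum>j<N. h N j y) \<longlonglongrightarrow> 1" if y: "y \<in> S" for y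
  proof -
    obtain i where i: "dist (x i) y < r i" using cover y by auto
    then have pos: "0 < \<phi> i y" by (simp add: \<phi>_def)
    \<comment> \<open>The tents may be arbitrarily small at \<open>y\<close>; the factor
      \<open>N\<close> in \<open>s\<close> nevertheless lifts their sum to the truncation level 1
      once \<open>N\<close> reaches \<open>1 / \<phi> i y\<close>. The condition
      \<open>i < N\<close> puts \<open>\<phi> i\<close> among the summands.\<close>
    have "\<forall>\<^sub>F N in sequentially. s N N y = 1"
      using eventually_gt_at_top[of i] eventually_ge_at_top[of "nat \<lceil>1 / \<phi> i y\<rceil>"]
    proof eventually_elim
      case (elim N)
      then have "1 / \<phi> i y \<le> real N" by linarith
      then have "1 \<le> real N * \<phi> i y" using pos by (simp add: field_simps)
      also have "\<dots> \<le> real N * (\<Sum>i<N. \<phi> i y)"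
        using elim(1) \<phi>_nonneg by (intro mult_left_mono member_le_sum) auto
      finally show ?case by (simp add: s_def)
    qed
    then show ?thesis unfolding sum_h by (rule tendsto_eventually)
  qed
qed

text \<open>Only finitely many balls enter the estimate, so the local hypothesis
  \<open>equi\<close>, whose threshold in \<open>n\<close> may depend on the point \<open>x\<close>,
  yields a threshold valid for all \<open>b\<close>. The second clause of \<open>equi\<close>
  accounts for integrands that change together with the measures. The partition functions are
  continuous on the whole type, hence the form of \<open>conv\<close>.\<close>

lemma weak_convergence_uniform:
  fixes S :: "'c::{metric_space, second_countable_topology} set"
    and g :: "nat \<Rightarrow> 'b \<Rightarrow> 'c \<Rightarrow> real" and g\<^sub>0 :: "'b \<Rightarrow> 'c \<Rightarrow> real"
  assumes \<mu>: "\<And>n. prob_space (\<mu> n)" "\<And>n. sets (\<mu> n) = sets (borel_on S)"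
    and \<nu>: "prob_space \<nu>" "sets \<nu> = sets (borel_on S)"
    and conv: "\<And>h :: 'c \<Rightarrow> real. continuous_on UNIV h \<Longrightarrow> bounded (range h) \<Longrightarrow>
      (\<lambda>n. \<integral>y. h y \<partial>\<mu> n) \<longlonglongrightarrow> (\<integral>y. h y \<partial>\<nu>)"
    and g: "\<And>n b. b \<in> I \<Longrightarrow> g n b \<in> borel_measurable (borel_on S)"
      "\<And>n b y. b \<in> I \<Longrightarrow> y \<in> S \<Longrightarrow> \<bar>g n b y\<bar> \<le> M"
    and g\<^sub>0: "\<And>b. b \<in> I \<Longrightarrow> g\<^sub>0 b \<in> borel_measurable (borel_on S)"
      "\<And>b y. b \<in> I \<Longrightarrow> y \<in> S \<Longrightarrow> \<bar>g\<^sub>0 b y\<bar> \<le> M"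
    and equi: "\<And>x e. x \<in> S \<Longrightarrow> 0 < e \<Longrightarrow>
      \<exists>r>0. (\<forall>b\<in>I. \<forall>y\<in>S. dist x y < r \<longrightarrow> \<bar>g\<^sub>0 b y - g\<^sub>0 b x\<bar> \<le> e) \<and>
        (\<forall>\<^sub>F n in sequentially. \<forall>b\<in>I. \<forall>y\<in>S. dist x y < r \<longrightarrow> \<bar>g n b y - g\<^sub>0 b x\<bar> \<le> e)"
    and e: "0 < e"
  shows "\<forall>\<^sub>F n in sequentially. \<forall>b\<in>I. \<bar>(\<integral>y. g n b y \<partial>\<mu> n) - (\<integral>y. g\<^sub>0 b y \<partial>\<nu>)\<bar> \<le> e"
proof (cases "I = {}")
  case False
  have sp: "space \<nu> = S"
    using sets_eq_imp_space_eq[OF \<nu>(2)] by (simp add: space_restrict_space)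
  interpret \<nu>: prob_space \<nu> by fact
  \<comment> \<open>A point of \<open>S\<close> and an element of \<open>I\<close> are needed to see
    that the bound \<open>M\<close> is nonnegative; for empty \<open>I\<close> the claim is
    vacuous.\<close>
  have "S \<noteq> {}" using \<nu>.not_empty sp by simp
  then have M: "0 \<le> M" using g\<^sub>0(2) False by fastforce
  have "\<forall>x\<in>S. \<exists>r>0. (\<forall>b\<in>I. \<forall>y\<in>S. dist x y < r \<longrightarrow> \<bar>g\<^sub>0 b y - g\<^sub>0 b x\<bar> \<le> e / 4) \<and>
        (\<forall>\<^sub>F n in sequentially. \<forall>b\<in>I. \<forall>y\<in>S. dist x y < r \<longrightarrow> \<bar>g n b y - g\<^sub>0 b x\<bar> \<le> e / 4)"
    using e by (intro ballI equi) simp_all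
  from bchoice[OF this] obtain r where r': "\<forall>x\<in>S. 0 < r x \<and>
        (\<forall>b\<in>I. \<forall>y\<in>S. dist x y < r x \<longrightarrow> \<bar>g\<^sub>0 b y - g\<^sub>0 b x\<bar> \<le> e / 4) \<and>
        (\<forall>\<^sub>F n in sequentially. \<forall>b\<in>I. \<forall>y\<in>S. dist x y < r x \<longrightarrow> \<bar>g n b y - g\<^sub>0 b x\<bar> \<le> e / 4)" ..
  then have r: "\<And>x. x \<in> S \<Longrightarrow> 0 < r x"
    "\<And>x b y. x \<in> S \<Longrightarrow> b \<in> I \<Longrightarrow> y \<in> S \<Longrightarrow> dist x y < r x \<Longrightarrow> \<bar>g\<^sub>0 b y - g\<^sub>0 b x\<bar> \<le> e / 4"
    "\<And>x. x \<in> S \<Longrightarrow> \<forall>\<^sub>F n in sequentially. \<forall>b\<in>I. \<forall>y\<in>S. dist x y < r x \<longrightarrow> \<bar>g n b y - g\<^sub>0 b x\<bar> \<le> e / 4"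
    using r' by blast+
  obtain x where x: "\<And>i::nat. x i \<in> S" "S \<subseteq> (\<Union>i. ball (x i) (r (x i)))"
    by (rule countable_ball_cover[where r=r, OF \<open>S \<noteq> {}\<close> r(1)]) blast+
  obtain h :: "nat \<Rightarrow> nat \<Rightarrow> 'c \<Rightarrow> real" where
    h: "\<And>N j. continuous_on UNIV (h N j)" "\<And>N j y. 0 \<le> h N j y" "\<And>N y. (\<Sum>j<N. h N j y) \<le> 1"
      "\<And>N j y. h N j y \<noteq> 0 \<Longrightarrow> dist (x j) y < r (x j)"
      "\<And>y. y \<in> S \<Longrightarrow> (\<lambda>N. \<Sum>j<N. h N j y) \<longlonglongrightarrow> 1"
    by (rule continuous_partition[OF x(2)]) blast
  have h_le: "h N j y \<le> 1" if "j < N" for N j y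
    using member_le_sum[of j "{..<N}" "\<lambda>j. h N j y"] that h(2) h(3)[of N y] by (simp add: order_trans)
  have h_meas: "h N j \<in> borel_measurable \<nu>" for N j
    by (intro measurable_borel_on_if_borel[OF _ \<nu>(2)] borel_measurable_continuous_onI h)
  have int_h: "integrable \<nu> (h N j)" if "j < N" for N j
    using h(2) h_le[OF that] by (intro \<nu>.integrable_const_bound[where B=1] h_meas) auto
  \<comment> \<open>The errors below add up to \<open>e / 2 + 4 * M * \<delta>\<close>, hence the
    bound \<open>M * \<delta> \<le> e / 8\<close>. The summand 1 in the denominator covers the case
    \<open>M = 0\<close>.\<close>
  define \<delta> where "\<delta> = e / (8 * (M + 1))"
  have \<delta>: "0 < \<delta>" using e M by (simp add: \<delta>_def)
  have M\<delta>: "M * \<delta> \<le> e / 8"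
    using e M by (simp add: \<delta>_def field_simps)
  \<comment> \<open>Dominated convergence provides an \<open>N\<close> for which the partition
    misses less than \<open>\<delta>\<close> of the mass of \<open>\<nu>\<close>; this
    \<open>N\<close> stays fixed from here on.\<close>
  have "(\<lambda>N. \<integral>y. (\<Sum>j<N. h N j y) \<partial>\<nu>) \<longlonglongrightarrow> (\<integral>y. 1 \<partial>\<nu>)"
  proof (rule integral_dominated_convergence[where w="\<lambda>_. 1"])
    show "AE y in \<nu>. norm (\<Sum>j<N. h N j y) \<le> 1" for N
      using h(2,3) by (auto simp: sum_nonneg)
  qed (use h_meas h(5) in \<open>auto simp: sp\<close>)
  then have "\<forall>\<^sub>F N in sequentially. 1 - \<delta> < (\<integral>y. (\<Sum>j<N. h N j y) \<partial>\<nu>)"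
    by (rule order_tendstoD(1)) (use \<delta> in \<open>simp add: \<nu>.prob_space\<close>)
  then obtain N where "1 - \<delta> < (\<integral>y. (\<Sum>j<N. h N j y) \<partial>\<nu>)"
    using eventually_happens'[OF sequentially_bot] by blast
  then have N: "1 - \<delta> < (\<Sum>j<N. \<integral>y. h N j y \<partial>\<nu>)"
    using int_h by (subst (asm) Bochner_Integration.integral_sum) auto
  \<comment> \<open>This single quantity is free of \<open>b\<close> and controls both the weighted
    sums, whose coefficients are at most \<open>M\<close> in absolute value, and the change in the
    mass captured by the partition.\<close>
  have "(\<lambda>n. \<Sum>j<N. \<bar>(\<integral>y. h N j y \<partial>\<mu> n) - (\<integral>y. h N j y \<partial>\<nu>)\<bar>) \<longlonglongrightarrow> (\<Sum>j<N. 0)"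
  proof (intro tendsto_sum tendsto_rabs_zero)
    fix j assume "j \<in> {..<N}"
    then have "(\<lambda>n. \<integral>y. h N j y \<partial>\<mu> n) \<longlonglongrightarrow> (\<integral>y. h N j y \<partial>\<nu>)"
      using h(2) h_le by (intro conv h boundedI[where B=1]) auto
    then show "(\<lambda>n. (\<integral>y. h N j y \<partial>\<mu> n) - (\<integral>y. h N j y \<partial>\<nu>)) \<longlonglongrightarrow> 0"
      using LIM_zero by blast
  qed
  then have ev1: "\<forall>\<^sub>F n in sequentially. (\<Sum>j<N. \<bar>(\<integral>y. h N j y \<partial>\<mu> n) - (\<integral>y. h N j y \<partial>\<nu>)\<bar>) < \<delta>"
    using \<delta> by (intro order_tendstoD(2)) simp_all
  have ev2: "\<forall>\<^sub>F n in sequentially. \<forall>j\<in>{..<N}. \<forall>b\<in>I. \<forall>y\<in>S. dist (x j) y < r (x j) \<longrightarrow>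
      \<bar>g n b y - g\<^sub>0 b (x j)\<bar> \<le> e / 4"
    using r(3)[OF x(1)] by (intro eventually_ball_finite) auto
  show ?thesis
    using ev1 ev2
  proof (eventually_elim, intro ballI)
    fix n b
    let ?p = "\<lambda>j. \<integral>y. h N j y \<partial>\<mu> n" and ?q = "\<lambda>j. \<integral>y. h N j y \<partial>\<nu>" and ?c = "\<lambda>j. g\<^sub>0 b (x j)"
    assume d: "(\<Sum>j<N. \<bar>?p j - ?q j\<bar>) < \<delta>" and b: "b \<in> I"
      and osc: "\<forall>j\<in>{..<N}. \<forall>b\<in>I. \<forall>y\<in>S. dist (x j) y < r (x j) \<longrightarrow> \<bar>g n b y - g\<^sub>0 b (x j)\<bar> \<le> e / 4"
    have 1: "\<bar>(\<integral>y. g n b y \<partial>\<mu> n) - (\<Sum>j<N. ?c j * ?p j)\<bar> \<le> e / 4 + M * (1 - (\<Sum>j<N. ?p j))"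
      using osc b g[OF b] h e \<mu>(2)[of n]
      by (intro integral_partition_approx[OF \<mu>(1,2)]) (auto cong: measurable_cong_sets)
    have 2: "\<bar>(\<integral>y. g\<^sub>0 b y \<partial>\<nu>) - (\<Sum>j<N. ?c j * ?q j)\<bar> \<le> e / 4 + M * (1 - (\<Sum>j<N. ?q j))"
      using r(2)[OF x(1) b] g\<^sub>0[OF b] h e \<nu>(2)
      by (intro integral_partition_approx[OF \<nu>]) (auto cong: measurable_cong_sets)
    have "\<bar>(\<Sum>j<N. ?c j * ?p j) - (\<Sum>j<N. ?c j * ?q j)\<bar> \<le> (\<Sum>j<N. \<bar>?c j * (?p j - ?q j)\<bar>)"
      by (simp add: sum_subtractf[symmetric] right_diff_distrib[symmetric] sum_abs )
    also have "\<dots> \<le> (\<Sum>j<N. M * \<bar>?p j - ?q j\<bar>)"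
      using g\<^sub>0(2)[OF b x(1)] by (intro sum_mono) (simp add: abs_mult mult_right_mono)
    also have "\<dots> \<le> M * \<delta>"
      using d M by (simp add: sum_distrib_left[symmetric] mult_left_mono)
    finally have 3: "\<bar>(\<Sum>j<N. ?c j * ?p j) - (\<Sum>j<N. ?c j * ?q j)\<bar> \<le> M * \<delta>" .
    \<comment> \<open>The missing mass is below \<open>\<delta>\<close> for \<open>\<nu>\<close>, so
      it is at most \<open>2 * \<delta>\<close> for \<open>\<mu> n\<close>.\<close>
    have "\<bar>(\<Sum>j<N. ?p j) - (\<Sum>j<N. ?q j)\<bar> \<le> \<delta>"
      using d sum_abs[of "\<lambda>j. ?p j - ?q j" "{..<N}"] by (simp add: sum_subtractf)
    then have "1 - (\<Sum>j<N. ?p j) \<le> 2 * \<delta>" "1 - (\<Sum>j<N. ?q j) \<le> \<delta>"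
      using N by linarith+
    then have "M * (1 - (\<Sum>j<N. ?p j)) \<le> M * (2 * \<delta>)" "M * (1 - (\<Sum>j<N. ?q j)) \<le> M * \<delta>"
      using M by (auto intro: mult_left_mono)
    then show "\<bar>(\<integral>y. g n b y \<partial>\<mu> n) - (\<integral>y. g\<^sub>0 b y \<partial>\<nu>)\<bar> \<le> e"
      using 1 2 3 M\<delta> by linarith
  qed
qed simp

section \<open>Integrals over slices as integrals over the product\<close>

text \<open>Written over the product space, the integral against a slice measure becomes the
  integral of a fixed function against \<open>\<Phi>\<close>. In this form its measurability in
  \<open>\<Phi>\<close> and its behaviour under \<open>bind\<close> follow from general
  facts.\<close>

definition slice_integral :: "('a \<Rightarrow> real) \<Rightarrow> 'b set \<Rightarrow> ('a \<times> 'b) measure \<Rightarrow> real" where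
  "slice_integral f B \<Phi> = (\<integral>z. f (fst z) * indicator B (snd z) \<partial>\<Phi>)"

lemma measurable_fst_borel_on [measurable]: "fst \<in> borel_on (S1 \<times> S2) \<rightarrow>\<^sub>M borel_on S1"
  by (intro measurable_restrict_space2 measurable_restrict_space1 borel_measurable_continuous_onI
      continuous_intros) (auto simp: space_restrict_space)

lemma measurable_snd_borel_on [measurable]: "snd \<in> borel_on (S1 \<times> S2) \<rightarrow>\<^sub>M borel_on S2"
  by (intro measurable_restrict_space2 measurable_restrict_space1 borel_measurable_continuous_onI
      continuous_intros) (auto simp: space_restrict_space)

lemma measurable_slice_integrand:
  assumes [measurable]: "f \<in> borel_measurable (borel_on S1)" "B \<in> sets (borel_on S2)"
  shows "(\<lambda>z. f (fst z) * indicator B (snd z) :: real) \<in> borel_measurable (borel_on (S1 \<times> S2))"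
  by measurable

text \<open>Restricting \<open>\<Phi>\<close> to second coordinates in \<open>B\<close> is a
  density, and forgetting the second coordinate is an image measure; both sides thus give
  \<open>A\<close> the mass of \<open>A \<times> B\<close>. The representation opens slice measures
  to the transformation rules for integrals.\<close>

lemma slice_measure_eq_distr:
  assumes S: "S1 \<in> sets borel" "S2 \<in> sets borel"
    and \<Phi>: "sets \<Phi> = sets (borel_on (S1 \<times> S2))"
    and B [measurable]: "B \<in> sets (borel_on S2)"
  shows "slice_measure S1 \<Phi> B =
    distr (density \<Phi> (\<lambda>z. ennreal (indicator B (snd z)))) (borel_on S1) fst"
proof (rule measure_eqI)
  note [measurable_cong] = \<Phi>
  have "sigma_sets S1 (sets (borel_on S1)) = sets (borel_on S1)"
    using sets.sigma_sets_eq[of "borel_on S1"] by (simp add: space_restrict_space)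
  moreover have "sets (borel_on S1) \<subseteq> Pow S1"
    using sets.space_closed[of "borel_on S1"] by (simp add: space_restrict_space)
  ultimately have sets: "sets (slice_measure S1 \<Phi> B) = sets (borel_on S1)"
    by (simp add: slice_measure_def sets_measure_of)
  then show "sets (slice_measure S1 \<Phi> B) =
      sets (distr (density \<Phi> (\<lambda>z. ennreal (indicator B (snd z)))) (borel_on S1) fst)"
    by simp
  fix A assume "A \<in> sets (slice_measure S1 \<Phi> B)"
  then have A [measurable]: "A \<in> sets (borel_on S1)" using sets by simp
  have AB: "A \<times> B \<in> sets \<Phi>"
    using A B S \<Phi> by (auto simp: sets_restrict_space_iff borel_Times)
  have [measurable]: "fst \<in> \<Phi> \<rightarrow>\<^sub>M borel_on S1" "snd \<in> \<Phi> \<rightarrow>\<^sub>M borel_on S2"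
    by measurable
  have "emeasure (distr (density \<Phi> (\<lambda>z. ennreal (indicator B (snd z)))) (borel_on S1) fst) A
      = (\<integral>\<^sup>+z. ennreal (indicator B (snd z)) * indicator (fst -` A \<inter> space \<Phi>) z \<partial>\<Phi>)"
    by (subst emeasure_distr) (auto simp: emeasure_density)
  also have "\<dots> = (\<integral>\<^sup>+z. indicator (A \<times> B) z \<partial>\<Phi>)"
    by (intro nn_integral_cong) (auto simp: indicator_def)
  also have "\<dots> = emeasure (slice_measure S1 \<Phi> B) A"
    using AB by (simp add: emeasure_slice_measure[OF S \<Phi> A B])
  finally show "emeasure (slice_measure S1 \<Phi> B) A =
      emeasure (distr (density \<Phi> (\<lambda>z. ennreal (indicator B (snd z)))) (borel_on S1) fst) A" ..
qed

lemma integral_slice_measure: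
  fixes f :: "'a::topological_space \<Rightarrow> real"
  assumes S: "S1 \<in> sets borel" "S2 \<in> sets borel"
    and \<Phi>: "sets \<Phi> = sets (borel_on (S1 \<times> S2))"
    and B [measurable]: "B \<in> sets (borel_on S2)"
    and f [measurable]: "f \<in> borel_measurable (borel_on S1)"
  shows "(\<integral>s. f s \<partial>slice_measure S1 \<Phi> B) = slice_integral f B \<Phi>"
proof -
  note [measurable_cong] = \<Phi>
  have [measurable]: "fst \<in> \<Phi> \<rightarrow>\<^sub>M borel_on S1" "snd \<in> \<Phi> \<rightarrow>\<^sub>M borel_on S2"
    by measurable
  show ?thesis
    unfolding slice_measure_eq_distr[OF S \<Phi> B] slice_integral_def
    by (subst integral_distr, simp_all) (subst integral_density, simp_all add: mult.commute)
qed

lemma abs_slice_integral_le: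
  assumes "prob_space \<Phi>" "sets \<Phi> = sets (borel_on (S1 \<times> S2))"
    and f: "f \<in> borel_measurable (borel_on S1)" "\<And>x. x \<in> S1 \<Longrightarrow> \<bar>f x\<bar> \<le> M"
    and B: "B \<in> sets (borel_on S2)"
  shows "\<bar>slice_integral f B \<Phi>\<bar> \<le> M"
proof -
  interpret prob_space \<Phi> by fact
  have sp: "space \<Phi> = S1 \<times> S2"
    using sets_eq_imp_space_eq[OF assms(2)] by (simp add: space_restrict_space)
  have bd: "\<bar>f (fst z) * indicator B (snd z)\<bar> \<le> M" if "z \<in> space \<Phi>" for z
    using f(2)[of "fst z"] that sp by (auto simp: indicator_def mem_Times_iff)
  have int: "integrable \<Phi> (\<lambda>z. f (fst z) * indicator B (snd z))"
    using bd measurable_slice_integrand[OF f(1) B] assms(2)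
    by (intro integrable_const_bound[where B=M]) (auto cong: measurable_cong_sets)
  have "\<bar>slice_integral f B \<Phi>\<bar> \<le> (\<integral>z. \<bar>f (fst z) * indicator B (snd z)\<bar> \<partial>\<Phi>)"
    unfolding slice_integral_def by (rule integral_abs_bound)
  also have "\<dots> \<le> (\<integral>z. M \<partial>\<Phi>)"
    using int bd by (intro integral_mono) auto
  finally show ?thesis by (simp add: prob_space)
qed

section \<open>The semi-uniform Feller property as equicontinuity\<close>

text \<open>A real supremum can be compared with its members only over a nonempty index set and with
  an upper bound; the bound \<open>C\<close> supplies the latter.\<close>

lemma SUP_abs_tendsto_zero_iff:
  fixes a :: "nat \<Rightarrow> 'b \<Rightarrow> real"
  assumes "I \<noteq> {}" and bdd: "\<And>n b. b \<in> I \<Longrightarrow> \<bar>a n b\<bar> \<le> C"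
  shows "(\<lambda>n. SUP b\<in>I. \<bar>a n b\<bar>) \<longlonglongrightarrow> 0 \<longleftrightarrow>
    (\<forall>e>0. \<forall>\<^sub>F n in sequentially. \<forall>b\<in>I. \<bar>a n b\<bar> \<le> e)"
proof -
  have bdd': "bdd_above ((\<lambda>b. \<bar>a n b\<bar>) ` I)" for n
    using bdd by (intro bdd_aboveI2)
  have upper: "\<bar>a n b\<bar> \<le> (SUP b\<in>I. \<bar>a n b\<bar>)" if "b \<in> I" for n b
    using that bdd' by (rule cSUP_upper)
  have nonneg: "0 \<le> (SUP b\<in>I. \<bar>a n b\<bar>)" for n
    using \<open>I \<noteq> {}\<close> upper abs_ge_zero order_trans by (metis ex_in_conv)
  show ?thesis
  proof
    assume lim: "(\<lambda>n. SUP b\<in>I. \<bar>a n b\<bar>) \<longlonglongrightarrow> 0"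
    show "\<forall>e>0. \<forall>\<^sub>F n in sequentially. \<forall>b\<in>I. \<bar>a n b\<bar> \<le> e"
    proof (intro allI impI)
      fix e :: real assume "0 < e"
      with lim have "\<forall>\<^sub>F n in sequentially. (SUP b\<in>I. \<bar>a n b\<bar>) < e"
        by (rule order_tendstoD(2))
      then show "\<forall>\<^sub>F n in sequentially. \<forall>b\<in>I. \<bar>a n b\<bar> \<le> e"
        by eventually_elim (blast intro: order_trans[OF upper less_imp_le])
    qed
  next
    assume ev: "\<forall>e>0. \<forall>\<^sub>F n in sequentially. \<forall>b\<in>I. \<bar>a n b\<bar> \<le> e"
    show "(\<lambda>n. SUP b\<in>I. \<bar>a n b\<bar>) \<longlonglongrightarrow> 0"
    proof (rule tendstoI)
      fix e :: real assume "0 < e"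
      \<comment> \<open>Half of \<open>e\<close> is used because bounds on the members give only a
        weak inequality for the supremum.\<close>
      then have "\<forall>\<^sub>F n in sequentially. \<forall>b\<in>I. \<bar>a n b\<bar> \<le> e / 2"
        using ev half_gt_zero by blast
      then show "\<forall>\<^sub>F n in sequentially. dist (SUP b\<in>I. \<bar>a n b\<bar>) 0 < e"
      proof eventually_elim
        case (elim n)
        then have "(SUP b\<in>I. \<bar>a n b\<bar>) \<le> e / 2" using \<open>I \<noteq> {}\<close> by (intro cSUP_least) auto
        then show ?case using nonneg[of n] \<open>0 < e\<close> by (simp add: dist_real_def)
      qed
    qed
  qed
qed

text \<open>The values of the kernel are probability measures, so slice integrals are bounded by any
  bound of \<open>\<bar>f\<bar>\<close> on \<open>S1\<close>, and their differences by twice that.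
  This applies at the limit \<open>t\<close> too, as limits lie in the space. The criterion removes
  slice measures and suprema for both kernels at once.\<close>

lemma semi_uniform_feller_iff:
  fixes S1 :: "'a::topological_space set" and S2 :: "'b::topological_space set"
  assumes S: "S1 \<in> sets borel" "S2 \<in> sets borel" and \<Psi>: "stochastic_kernel S1 S2 T \<Psi>"
  shows "semi_uniform_feller S1 S2 T \<Psi> \<longleftrightarrow>
    (\<forall>\<tau> t. (\<forall>n. \<tau> n \<in> topspace T) \<longrightarrow> limitin T \<tau> t sequentially \<longrightarrow>
      (\<forall>f :: 'a \<Rightarrow> real. continuous_on S1 f \<longrightarrow> bounded (f ` S1) \<longrightarrow>
        (\<forall>e>0. \<forall>\<^sub>F n in sequentially. \<forall>B\<in>sets (borel_on S2).
          \<bar>slice_integral f B (\<Psi> (\<tau> n)) - slice_integral f B (\<Psi> t)\<bar> \<le> e)))"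
proof -
  have "(\<lambda>n. SUP B \<in> sets (borel_on S2).
            \<bar>(\<integral>s. f s \<partial>slice_measure S1 (\<Psi> (\<tau> n)) B) - (\<integral>s. f s \<partial>slice_measure S1 (\<Psi> t) B)\<bar>)
         \<longlonglongrightarrow> 0 \<longleftrightarrow>
        (\<forall>e>0. \<forall>\<^sub>F n in sequentially. \<forall>B\<in>sets (borel_on S2).
          \<bar>slice_integral f B (\<Psi> (\<tau> n)) - slice_integral f B (\<Psi> t)\<bar> \<le> e)"
    if \<tau>: "\<forall>n. \<tau> n \<in> topspace T" and lim: "limitin T \<tau> t sequentially"
      and f: "continuous_on S1 f" "bounded (f ` S1)" for \<tau> t and f :: "'a \<Rightarrow> real"
  proof -
    have t: "t \<in> topspace T" using lim by (rule limitin_topspace)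
    have fm: "f \<in> borel_measurable (borel_on S1)"
      using f(1) by (rule borel_measurable_continuous_on_restrict)
    obtain M where M: "\<And>x. x \<in> S1 \<Longrightarrow> \<bar>f x\<bar> \<le> M"
      using f(2) by (auto simp: bounded_iff)
    have K: "prob_space (\<Psi> u)" "sets (\<Psi> u) = sets (borel_on (S1 \<times> S2))" if "u \<in> topspace T" for u
      using \<Psi> that by (auto simp: stochastic_kernel_def)
    have eq: "(\<integral>s. f s \<partial>slice_measure S1 (\<Psi> u) B) = slice_integral f B (\<Psi> u)"
      if "u \<in> topspace T" "B \<in> sets (borel_on S2)" for u B
      using integral_slice_measure[OF S K(2)[OF that(1)] that(2) fm] .
    have le: "\<bar>slice_integral f B (\<Psi> u)\<bar> \<le> M" if "u \<in> topspace T" "B \<in> sets (borel_on S2)" for u B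
      using K[OF that(1)] fm M that(2) by (rule abs_slice_integral_le)
    have "(\<lambda>n. SUP B \<in> sets (borel_on S2).
            \<bar>(\<integral>s. f s \<partial>slice_measure S1 (\<Psi> (\<tau> n)) B) - (\<integral>s. f s \<partial>slice_measure S1 (\<Psi> t) B)\<bar>) =
          (\<lambda>n. SUP B \<in> sets (borel_on S2).
            \<bar>slice_integral f B (\<Psi> (\<tau> n)) - slice_integral f B (\<Psi> t)\<bar>)"
      using \<tau> t by (intro ext SUP_cong refl) (simp add: eq)
    moreover have "\<bar>slice_integral f B (\<Psi> (\<tau> n)) - slice_integral f B (\<Psi> t)\<bar> \<le> 2 * M"
      if "B \<in> sets (borel_on S2)" for B n
      using le[OF _ that, of "\<tau> n"] le[OF t that] \<tau> by force
    ultimately show ?thesis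
      by (subst SUP_abs_tendsto_zero_iff[where C="2 * M", symmetric]) auto
  qed
  then show ?thesis
    unfolding semi_uniform_feller_def by blast
qed

text \<open>In a metric space a property that holds eventually along every sequence tending to
  \<open>t\<close> holds near \<open>t\<close>. The property chosen here already quantifies over all
  \<open>B\<close>, so one radius serves them all. The sequences avoid \<open>t\<close> itself,
  where the difference is zero.\<close>

lemma semi_uniform_feller_equicontinuous:
  fixes S1 :: "'a::topological_space set" and S2 :: "'b::topological_space set"
    and S :: "'t::metric_space set" and f :: "'a \<Rightarrow> real"
  assumes "S1 \<in> sets borel" "S2 \<in> sets borel" "stochastic_kernel S1 S2 (top_of_set S) \<Psi>"
    and feller: "semi_uniform_feller S1 S2 (top_of_set S) \<Psi>"
    and f: "continuous_on S1 f" "bounded (f ` S1)" and t: "t \<in> S" and e: "0 < e"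
  obtains r where "0 < r" "\<And>u B. u \<in> S \<Longrightarrow> dist u t < r \<Longrightarrow> B \<in> sets (borel_on S2) \<Longrightarrow>
    \<bar>slice_integral f B (\<Psi> u) - slice_integral f B (\<Psi> t)\<bar> \<le> e"
proof -
  let ?P = "\<lambda>u. \<forall>B\<in>sets (borel_on S2). \<bar>slice_integral f B (\<Psi> u) - slice_integral f B (\<Psi> t)\<bar> \<le> e"
  have "eventually ?P (at t within S)"
  proof (intro sequentially_imp_eventually_within allI impI, elim conjE)
    fix \<tau> :: "nat \<Rightarrow> 't" assume \<tau>: "\<forall>n. \<tau> n \<in> S \<and> \<tau> n \<noteq> t" "\<tau> \<longlonglongrightarrow> t"
    then have "limitin (top_of_set S) \<tau> t sequentially"
      using t by (simp add: limitin_subtopology)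
    then show "\<forall>\<^sub>F n in sequentially. ?P (\<tau> n)"
      using feller f \<tau>(1) e unfolding semi_uniform_feller_iff[OF assms(1-3)] by auto
  qed
  then obtain r where r: "0 < r" "\<And>u. u \<in> S \<Longrightarrow> u \<noteq> t \<Longrightarrow> dist u t < r \<Longrightarrow> ?P u"
    unfolding eventually_at by blast
  moreover have "?P t" using e by simp
  ultimately show thesis
    using that[of r] by metis
qed

section \<open>Measures determined by rectangles, and integrals against mixtures\<close>

text \<open>The identity, written as \<open>(fst z, snd z)\<close>, is measurable in both
  directions. Second countability enters in the measurability of a pair into the Borel sets of the
  product.\<close>

lemma sets_borel_on_Times:
  fixes S1 :: "'a::second_countable_topology set" and S2 :: "'b::second_countable_topology set"
  assumes "S1 \<in> sets borel" "S2 \<in> sets borel"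
  shows "sets (borel_on (S1 \<times> S2)) = sets (borel_on S1 \<Otimes>\<^sub>M borel_on S2)"
proof (rule antisym)
  have "(\<lambda>z. (fst z, snd z)) \<in> borel_on S1 \<Otimes>\<^sub>M borel_on S2 \<rightarrow>\<^sub>M borel_on (S1 \<times> S2)"
  proof (rule measurable_restrict_space2)
    show "(\<lambda>z. (fst z, snd z)) \<in> borel_on S1 \<Otimes>\<^sub>M borel_on S2 \<rightarrow>\<^sub>M (borel :: ('a \<times> 'b) measure)"
      by (intro borel_measurable_Pair measurable_compose[OF measurable_fst]
          measurable_compose[OF measurable_snd]) (simp_all add: measurable_restrict_space1)
  qed (auto simp: space_pair_measure space_restrict_space)
  from measurable_sets[OF this]
  show "sets (borel_on (S1 \<times> S2)) \<subseteq> sets (borel_on S1 \<Otimes>\<^sub>M borel_on S2)"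
    using sets.sets_into_space[of _ "borel_on (S1 \<times> S2)"]
    by (auto simp: space_pair_measure space_restrict_space vimage_def Int_absorb2)
  have "(\<lambda>z. (fst z, snd z)) \<in> borel_on (S1 \<times> S2) \<rightarrow>\<^sub>M borel_on S1 \<Otimes>\<^sub>M borel_on S2"
    by measurable
  from measurable_sets[OF this]
  show "sets (borel_on S1 \<Otimes>\<^sub>M borel_on S2) \<subseteq> sets (borel_on (S1 \<times> S2))"
    using sets.sets_into_space[of _ "borel_on S1 \<Otimes>\<^sub>M borel_on S2"]
    by (auto simp: space_pair_measure space_restrict_space vimage_def Int_absorb2)
qed

text \<open>Rectangles are stable under intersection and generate the Borel sets of the product.
  This is how a kernel prescribed only on rectangles is identified as a measure.\<close>

lemma prob_measure_eqI_rectangles: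
  fixes S1 :: "'a::second_countable_topology set" and S2 :: "'b::second_countable_topology set"
  assumes S: "S1 \<in> sets borel" "S2 \<in> sets borel"
    and \<Phi>: "prob_space \<Phi>" "sets \<Phi> = sets (borel_on (S1 \<times> S2))"
    and \<Phi>': "prob_space \<Phi>'" "sets \<Phi>' = sets (borel_on (S1 \<times> S2))"
    and eq: "\<And>A B. A \<in> sets (borel_on S1) \<Longrightarrow> B \<in> sets (borel_on S2) \<Longrightarrow>
      measure \<Phi> (A \<times> B) = measure \<Phi>' (A \<times> B)"
  shows "\<Phi> = \<Phi>'"
proof -
  interpret \<Phi>: prob_space \<Phi> by fact
  interpret \<Phi>': prob_space \<Phi>' by fact
  let ?E = "{A \<times> B | A B. A \<in> sets (borel_on S1) \<and> B \<in> sets (borel_on S2)}"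
  have sigma: "sets (borel_on (S1 \<times> S2)) = sigma_sets (S1 \<times> S2) ?E"
    unfolding sets_borel_on_Times[OF S] sets_pair_measure by (simp add: space_restrict_space)
  show ?thesis
  proof (rule measure_eqI_generator_eq[where A="\<lambda>_. S1 \<times> S2"])
    show "Int_stable ?E" by (rule Int_stable_pair_measure_generator)
    show "?E \<subseteq> Pow (S1 \<times> S2)"
      using pair_measure_closed[of "borel_on S1" "borel_on S2"] by (simp add: space_restrict_space)
    show "range (\<lambda>_. S1 \<times> S2) \<subseteq> ?E"
      using sets.top[of "borel_on S1"] sets.top[of "borel_on S2"] by (auto simp: space_restrict_space)
  qed (use eq \<Phi>(2) \<Phi>'(2) sigma in \<open>auto simp: \<Phi>.emeasure_eq_measure \<Phi>'.emeasure_eq_measure\<close>)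
qed

lemma measurable_kernel_section:
  assumes \<Xi>: "stochastic_kernel S1 S2 (prod_topology (top_of_set S3) (top_of_set S4)) \<Xi>"
    and "S3 \<in> sets borel" "s \<in> S4"
  shows "(\<lambda>x. \<Xi> (x, s)) \<in> borel_on S3 \<rightarrow>\<^sub>M prob_algebra (borel_on (S1 \<times> S2))"
proof -
  have "continuous_map (top_of_set S3) (prod_topology (top_of_set S3) (top_of_set S4)) (\<lambda>x. (x, s))"
    using assms(3) by (intro continuous_map_pairedI) auto
  from measurable_compose[OF measurable_borel_of[OF this] measurable_stochastic_kernel[OF \<Xi>]]
  show ?thesis
    using sets_borel_of_top_of_set[OF assms(2)] by (simp cong: measurable_cong_sets)
qed

lemma measurable_slice_integral_section:
  assumes "stochastic_kernel S1 S2 (prod_topology (top_of_set S3) (top_of_set S4)) \<Xi>"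
    and "S3 \<in> sets borel" "s \<in> S4"
    and f: "f \<in> borel_measurable (borel_on S1)" and B: "B \<in> sets (borel_on S2)"
  shows "(\<lambda>x. slice_integral f B (\<Xi> (x, s))) \<in> borel_measurable (borel_on S3)"
  unfolding slice_integral_def
  by (rule measurable_compose[OF measurable_prob_algebraD[OF measurable_kernel_section[OF assms(1-3)]]
        integral_measurable_subprob_algebra[OF measurable_slice_integrand[OF f B]]])

text \<open>Integrating a bounded function against a mixture means integrating first against the
  kernel and then against the mixing measure. Through this identity a statement about the mixture
  becomes one about \<open>\<mu>\<close>-integrals of functions on \<open>S3\<close>.\<close>

lemma slice_integral_bind:
  assumes S3: "S3 \<in> sets borel" and s: "s \<in> S4"
    and \<Xi>: "stochastic_kernel S1 S2 (prod_topology (top_of_set S3) (top_of_set S4)) \<Xi>"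
    and \<mu>: "\<mu> \<in> space (prob_algebra (borel_on S3))"
    and f: "f \<in> borel_measurable (borel_on S1)" "\<And>x. x \<in> S1 \<Longrightarrow> \<bar>f x\<bar> \<le> M"
    and B: "B \<in> sets (borel_on S2)"
  shows "slice_integral f B (\<mu> \<bind> (\<lambda>x. \<Xi> (x, s))) = (\<integral>x. slice_integral f B (\<Xi> (x, s)) \<partial>\<mu>)"
  unfolding slice_integral_def
proof (rule integral_bind[where K="borel_on (S1 \<times> S2)" and B=M and B'=1])
  have sets: "sets \<mu> = sets (borel_on S3)" and "prob_space \<mu>"
    using \<mu> by (auto simp: space_prob_algebra)
  then show "finite_measure \<mu>" by (simp add: prob_space_def)
  have sp: "space \<mu> = S3"
    using sets_eq_imp_space_eq[OF sets] by (simp add: space_restrict_space)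
  show "(\<lambda>x. \<Xi> (x, s)) \<in> \<mu> \<rightarrow>\<^sub>M subprob_algebra (borel_on (S1 \<times> S2))"
    using measurable_prob_algebraD[OF measurable_kernel_section[OF \<Xi> S3 s]] sets
    by (simp cong: measurable_cong_sets)
  show "(\<lambda>z. f (fst z) * indicator B (snd z)) \<in> borel_measurable (borel_on (S1 \<times> S2))"
    by (rule measurable_slice_integrand[OF f(1) B])
  show "\<bar>f (fst z) * indicator B (snd z)\<bar> \<le> M" if "z \<in> space (borel_on (S1 \<times> S2))" for z
    using f(2)[of "fst z"] that by (auto simp: indicator_def space_restrict_space)
  show "AE x in \<mu>. emeasure (\<Xi> (x, s)) (space (\<Xi> (x, s))) \<le> ennreal 1"
    using \<Xi> s by (intro AE_I2) (simp add: sp stochastic_kernel_def prob_space.emeasure_space_1)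
qed

section \<open>Dirac measures and limits in the weak topology\<close>

text \<open>It suffices to pull back the generating sets. Integrating \<open>f\<close> against the
  Dirac measure at \<open>x\<close> gives \<open>f x\<close>, so the preimage of a generator is the
  preimage of an open set under \<open>f\<close>, which is open in \<open>S\<close>.\<close>

lemma continuous_map_return_weak_topology:
  "continuous_map (top_of_set S) (weak_topology S) (return (borel_on S))"
  unfolding weak_topology_def
proof (rule continuous_on_generated_topo)
  have ret: "return (borel_on S) x \<in> space (prob_algebra (borel_on S))" if "x \<in> S" for x
    using that by (auto simp: space_prob_algebra space_restrict_space intro!: prob_space_return)
  fix V assume "V \<in> {{\<mu> \<in> space (prob_algebra (borel_on S)). (\<integral>x. f x \<partial>\<mu>) \<in> U} | f U.
    continuous_on S f \<and> bounded (f ` S) \<and> open (U :: real set)}"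
  then obtain f :: "'a \<Rightarrow> real" and U where V: "V = {\<mu> \<in> space (prob_algebra (borel_on S)). (\<integral>x. f x \<partial>\<mu>) \<in> U}"
    "continuous_on S f" "open U" by auto
  have "(\<integral>y. f y \<partial>return (borel_on S) x) = f x" if "x \<in> S" for x
    using that V(2)
    by (intro integral_return borel_measurable_continuous_on_restrict) (simp_all add: space_restrict_space)
  then have "return (borel_on S) -` V \<inter> topspace (top_of_set S) = S \<inter> f -` U"
    using ret by (auto simp: V(1))
  then show "openin (top_of_set S) (return (borel_on S) -` V \<inter> topspace (top_of_set S))"
    using continuous_openin_preimage_gen[OF V(2,3)] by simp
next
  have "return (borel_on S) x \<in> topspace (weak_topology S)" if "x \<in> S" for x
    using that by (auto simp: space_prob_algebra space_restrict_space intro!: prob_space_return)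
  then show "return (borel_on S) ` topspace (top_of_set S) \<subseteq>
    \<Union> {{\<mu> \<in> space (prob_algebra (borel_on S)). (\<integral>x. f x \<partial>\<mu>) \<in> U} | f U.
      continuous_on S f \<and> bounded (f ` S) \<and> open (U :: real set)}"
    unfolding weak_topology_def topology_generated_by_topspace by auto
qed

lemma limitin_weak_topology_integral:
  fixes f :: "'a::topological_space \<Rightarrow> real"
  assumes "limitin (weak_topology S) \<mu> \<nu> F" "continuous_on S f" "bounded (f ` S)"
  shows "((\<lambda>n. \<integral>x. f x \<partial>\<mu> n) \<longlongrightarrow> (\<integral>x. f x \<partial>\<nu>)) F"
  using continuous_map_limit[OF continuous_map_integral_weak_topology[OF assms(2,3)] assms(1)]
  by (simp add: o_def)

section \<open>The equivalence\<close>

theorem theorem5: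
  fixes S1 :: "'a::polish_space set" and S2 :: "'b::polish_space set"
    and S3 :: "'c::polish_space set" and S4 :: "'d::polish_space set"
    and \<Xi> :: "'c \<times> 'd \<Rightarrow> ('a \<times> 'b) measure"
    and \<Xi>int :: "'c measure \<times> 'd \<Rightarrow> ('a \<times> 'b) measure"
  assumes "S1 \<in> sets borel" "S2 \<in> sets borel" "S3 \<in> sets borel" "S4 \<in> sets borel"
    and "stochastic_kernel S1 S2 (prod_topology (top_of_set S3) (top_of_set S4)) \<Xi>"
    and "stochastic_kernel S1 S2 (prod_topology (weak_topology S3) (top_of_set S4)) \<Xi>int"
    and "\<And>A B \<mu> s4. A \<in> sets (borel_on S1) \<Longrightarrow> B \<in> sets (borel_on S2) \<Longrightarrow>
           \<mu> \<in> space (prob_algebra (borel_on S3)) \<Longrightarrow> s4 \<in> S4 \<Longrightarrow>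
           measure (\<Xi>int (\<mu>, s4)) (A \<times> B) = (\<integral>s3. measure (\<Xi> (s3, s4)) (A \<times> B) \<partial>\<mu>)"
  shows "semi_uniform_feller S1 S2 (prod_topology (weak_topology S3) (top_of_set S4)) \<Xi>int \<longleftrightarrow>
         semi_uniform_feller S1 S2 (prod_topology (top_of_set S3) (top_of_set S4)) \<Xi>"
proof
  note S = assms(1-4) and \<Xi> = assms(5) and \<Xi>int = assms(6) and rect = assms(7)
  \<comment> \<open>\<open>\<Xi>int\<close> is known only on rectangles; agreement there with the
    mixture given by \<open>bind\<close> makes the two measures equal, so integrals against
    \<open>\<Xi>int\<close> can be computed.\<close>
  have mix: "\<Xi>int (\<mu>, s) = \<mu> \<bind> (\<lambda>x. \<Xi> (x, s))"
    if "\<mu> \<in> space (prob_algebra (borel_on S3))" "s \<in> S4" for \<mu> s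
  proof (rule prob_measure_eqI_rectangles[OF S(1,2)])
    note mixture = stochastic_kernel_mixture[OF S \<Xi>]
    show "prob_space (\<Xi>int (\<mu>, s))" "sets (\<Xi>int (\<mu>, s)) = sets (borel_on (S1 \<times> S2))"
      using \<Xi>int that by (auto simp: stochastic_kernel_def)
    show "prob_space (\<mu> \<bind> (\<lambda>x. \<Xi> (x, s)))"
      "sets (\<mu> \<bind> (\<lambda>x. \<Xi> (x, s))) = sets (borel_on (S1 \<times> S2))"
      using mixture(1) that by (auto simp: stochastic_kernel_def)
    show "measure (\<Xi>int (\<mu>, s)) (A \<times> B) = measure (\<mu> \<bind> (\<lambda>x. \<Xi> (x, s))) (A \<times> B)"
      if "A \<in> sets (borel_on S1)" "B \<in> sets (borel_on S2)" for A B
      using rect mixture(2) that \<open>\<mu> \<in> _\<close> \<open>s \<in> S4\<close> by simp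
  qed
  have slice_mix: "slice_integral f B (\<Xi>int (\<mu>, s)) = (\<integral>x. slice_integral f B (\<Xi> (x, s)) \<partial>\<mu>)"
    if f: "continuous_on S1 f" "bounded (f ` S1)" and B: "B \<in> sets (borel_on S2)"
      and \<mu>: "\<mu> \<in> space (prob_algebra (borel_on S3))" "s \<in> S4" for f :: "'a \<Rightarrow> real" and B \<mu> s
  proof -
    obtain M where "\<And>x. x \<in> S1 \<Longrightarrow> \<bar>f x\<bar> \<le> M"
      using f(2) by (auto simp: bounded_iff)
    then show ?thesis
      unfolding mix[OF \<mu>] using f(1) B \<mu>
      by (intro slice_integral_bind[OF S(3) _ \<Xi>] borel_measurable_continuous_on_restrict)
  qed
  have ret: "return (borel_on S3) x \<in> space (prob_algebra (borel_on S3))" if "x \<in> S3" for x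
    using that by (auto simp: space_prob_algebra space_restrict_space intro!: prob_space_return)
  have slice_return: "slice_integral f B (\<Xi>int (return (borel_on S3) x, s)) = slice_integral f B (\<Xi> (x, s))"
    if "continuous_on S1 f" "bounded (f ` S1)" "B \<in> sets (borel_on S2)" "x \<in> S3" "s \<in> S4"
    for f :: "'a \<Rightarrow> real" and B x s
    unfolding slice_mix[OF that(1-3) ret[OF that(4)] that(5)] using that
    by (intro integral_return measurable_slice_integral_section[OF \<Xi> S(3)]
        borel_measurable_continuous_on_restrict) (simp_all add: space_restrict_space)
  let ?T = "prod_topology (top_of_set S3) (top_of_set S4)"
  let ?W = "prod_topology (weak_topology S3) (top_of_set S4)"
  {
    assume feller: "semi_uniform_feller S1 S2 ?W \<Xi>int"
    show "semi_uniform_feller S1 S2 ?T \<Xi>"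
      unfolding semi_uniform_feller_iff[OF S(1,2) \<Xi>]
    proof (intro allI impI)
      fix \<tau> :: "nat \<Rightarrow> 'c \<times> 'd" and t and f :: "'a \<Rightarrow> real" and e :: real
      assume \<tau>: "\<forall>n. \<tau> n \<in> topspace ?T" and lim: "limitin ?T \<tau> t sequentially"
        and f: "continuous_on S1 f" "bounded (f ` S1)" and e: "0 < e"
      \<comment> \<open>The continuous map \<open>d\<close> carries a convergent sequence and its
        limit from \<open>?T\<close> to \<open>?W\<close> without changing the slice
        integrals.\<close>
      define d :: "'c \<times> 'd \<Rightarrow> 'c measure \<times> 'd" where "d u = (return (borel_on S3) (fst u), snd u)" for u
      have "t \<in> topspace ?T" using lim by (rule limitin_topspace)
      moreover have "slice_integral f B (\<Xi>int (d u)) = slice_integral f B (\<Xi> u)"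
        if "u \<in> topspace ?T" "B \<in> sets (borel_on S2)" for u B
        using slice_return[OF f that(2), of "fst u" "snd u"] that(1) by (auto simp: d_def)
      moreover have "limitin ?W (d \<circ> \<tau>) (d t) sequentially"
      proof (rule continuous_map_limit[OF _ lim])
        show "continuous_map ?T ?W d"
          unfolding d_def
          by (intro continuous_map_pairedI continuous_map_snd
              continuous_map_compose[OF continuous_map_fst continuous_map_return_weak_topology, unfolded o_def])
      qed
      moreover have "\<forall>n. (d \<circ> \<tau>) n \<in> topspace ?W"
        using \<tau> ret by (auto simp: d_def mem_Times_iff)
      ultimately show "\<forall>\<^sub>F n in sequentially. \<forall>B\<in>sets (borel_on S2).
          \<bar>slice_integral f B (\<Xi> (\<tau> n)) - slice_integral f B (\<Xi> t)\<bar> \<le> e"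
        using feller[unfolded semi_uniform_feller_iff[OF S(1,2) \<Xi>int], rule_format, of "d \<circ> \<tau>" "d t" f e] f e \<tau>
        by simp
    qed
  }
  assume feller: "semi_uniform_feller S1 S2 ?T \<Xi>"
  \<comment> \<open>As a subspace of a metric space, \<open>?T\<close> admits the neighbourhood form
    of the Feller property; for \<open>?W\<close> only convergent sequences are considered.\<close>
  have top: "?T = top_of_set (S3 \<times> S4)"
    by (simp add: subtopology_Times flip: euclidean_product_topology)
  show "semi_uniform_feller S1 S2 ?W \<Xi>int"
    unfolding semi_uniform_feller_iff[OF S(1,2) \<Xi>int]
  proof (intro allI impI)
    fix \<tau> :: "nat \<Rightarrow> 'c measure \<times> 'd" and t and f :: "'a \<Rightarrow> real" and e :: real
    assume \<tau>: "\<forall>n. \<tau> n \<in> topspace ?W" and lim: "limitin ?W \<tau> t sequentially"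
      and f: "continuous_on S1 f" "bounded (f ` S1)" and e: "0 < e"
    obtain M where M: "\<And>x. x \<in> S1 \<Longrightarrow> \<bar>f x\<bar> \<le> M"
      using f(2) by (auto simp: bounded_iff)
    have fm: "f \<in> borel_measurable (borel_on S1)"
      using f(1) by (rule borel_measurable_continuous_on_restrict)
    define \<mu> s where "\<mu> = fst \<circ> \<tau>" and "s = snd \<circ> \<tau>"
    obtain \<nu> s\<^sub>0 where t: "t = (\<nu>, s\<^sub>0)" by (cases t)
    have \<mu>: "\<mu> n \<in> space (prob_algebra (borel_on S3))" "s n \<in> S4" for n
      using \<tau>[rule_format, of n] by (auto simp: \<mu>_def s_def mem_Times_iff)
    have \<nu>: "\<nu> \<in> space (prob_algebra (borel_on S3))" "s\<^sub>0 \<in> S4"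
      using limitin_topspace[OF lim] by (auto simp: t)
    have lim_\<mu>: "limitin (weak_topology S3) \<mu> \<nu> sequentially" and lim_s: "s \<longlonglongrightarrow> s\<^sub>0"
      using lim by (auto simp: limitin_pairwise t \<mu>_def s_def limitin_subtopology)
    have le: "\<bar>slice_integral f B (\<Xi> (x, u))\<bar> \<le> M"
      if "x \<in> S3" "u \<in> S4" "B \<in> sets (borel_on S2)" for x u B
      using \<Xi> that fm M by (intro abs_slice_integral_le) (auto simp: stochastic_kernel_def)
    \<comment> \<open>The family is indexed by the Borel sets \<open>B\<close>; its members are the
      sections of the slice integrals at \<open>s n\<close>, with limits the sections at
      \<open>s\<^sub>0\<close>. Joint equicontinuity at \<open>(x, s\<^sub>0)\<close> yields both
      clauses of the local hypothesis.\<close>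
    have "\<forall>\<^sub>F n in sequentially. \<forall>B\<in>sets (borel_on S2).
        \<bar>(\<integral>x. slice_integral f B (\<Xi> (x, s n)) \<partial>\<mu> n) - (\<integral>x. slice_integral f B (\<Xi> (x, s\<^sub>0)) \<partial>\<nu>)\<bar> \<le> e"
    proof (rule weak_convergence_uniform[where S=S3 and M=M])
      show "prob_space (\<mu> n)" "sets (\<mu> n) = sets (borel_on S3)" for n
        using \<mu> by (auto simp: space_prob_algebra)
      show "prob_space \<nu>" "sets \<nu> = sets (borel_on S3)"
        using \<nu> by (auto simp: space_prob_algebra)
      show "(\<lambda>n. \<integral>y. h y \<partial>\<mu> n) \<longlonglongrightarrow> (\<integral>y. h y \<partial>\<nu>)"
        if "continuous_on UNIV h" "bounded (range h)" for h :: "'c \<Rightarrow> real"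
        using that by (intro limitin_weak_topology_integral[OF lim_\<mu>])
          (auto intro: continuous_on_subset bounded_subset)
      fix x and e' :: real assume x: "x \<in> S3" and e': "0 < e'"
      have "(x, s\<^sub>0) \<in> S3 \<times> S4" using x \<nu> by simp
      from semi_uniform_feller_equicontinuous[OF S(1,2) \<Xi>[unfolded top] feller[unfolded top] f this e']
      obtain r where r: "0 < r" "\<And>u B. u \<in> S3 \<times> S4 \<Longrightarrow> dist u (x, s\<^sub>0) < r \<Longrightarrow> B \<in> sets (borel_on S2) \<Longrightarrow>
          \<bar>slice_integral f B (\<Xi> u) - slice_integral f B (\<Xi> (x, s\<^sub>0))\<bar> \<le> e'" by blast
      \<comment> \<open>The product distance is at most the sum of the coordinate distances, so each
        coordinate is allowed half of the radius.\<close>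
      have near: "\<bar>slice_integral f B (\<Xi> (y, u)) - slice_integral f B (\<Xi> (x, s\<^sub>0))\<bar> \<le> e'"
        if "y \<in> S3" "u \<in> S4" "dist x y < r / 2" "dist u s\<^sub>0 < r / 2" "B \<in> sets (borel_on S2)" for y u B
      proof (rule r(2))
        have "dist (y, u) (x, s\<^sub>0) \<le> dist y x + dist u s\<^sub>0"
          unfolding dist_Pair_Pair by (rule sqrt_sum_squares_le_sum) simp_all
        then show "dist (y, u) (x, s\<^sub>0) < r" using that by (simp add: dist_commute)
      qed (use that in auto)
      have "\<forall>\<^sub>F n in sequentially. dist (s n) s\<^sub>0 < r / 2"
        using lim_s r(1) by (intro tendstoD) simp_all
      then have "\<forall>\<^sub>F n in sequentially. \<forall>B\<in>sets (borel_on S2). \<forall>y\<in>S3. dist x y < r / 2 \<longrightarrow>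
          \<bar>slice_integral f B (\<Xi> (y, s n)) - slice_integral f B (\<Xi> (x, s\<^sub>0))\<bar> \<le> e'"
        by eventually_elim (use near \<mu>(2) in blast)
      moreover have "\<forall>B\<in>sets (borel_on S2). \<forall>y\<in>S3. dist x y < r / 2 \<longrightarrow>
          \<bar>slice_integral f B (\<Xi> (y, s\<^sub>0)) - slice_integral f B (\<Xi> (x, s\<^sub>0))\<bar> \<le> e'"
        using near \<nu>(2) r(1) by simp
      ultimately show "\<exists>r>0. (\<forall>B\<in>sets (borel_on S2). \<forall>y\<in>S3. dist x y < r \<longrightarrow>
            \<bar>slice_integral f B (\<Xi> (y, s\<^sub>0)) - slice_integral f B (\<Xi> (x, s\<^sub>0))\<bar> \<le> e') \<and>
          (\<forall>\<^sub>F n in sequentially. \<forall>B\<in>sets (borel_on S2). \<forall>y\<in>S3. dist x y < r \<longrightarrow>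
            \<bar>slice_integral f B (\<Xi> (y, s n)) - slice_integral f B (\<Xi> (x, s\<^sub>0))\<bar> \<le> e')"
        using r(1) by (intro exI[of _ "r / 2"]) simp
    qed (use le \<mu>(2) \<nu>(2) fm e measurable_slice_integral_section[OF \<Xi> S(3)] in auto)
    then show "\<forall>\<^sub>F n in sequentially. \<forall>B\<in>sets (borel_on S2).
        \<bar>slice_integral f B (\<Xi>int (\<tau> n)) - slice_integral f B (\<Xi>int t)\<bar> \<le> e"
    proof eventually_elim
      case (elim n)
      have "\<tau> n = (\<mu> n, s n)" by (simp add: \<mu>_def s_def)
      then show ?case
        using elim slice_mix[OF f _ \<mu>] slice_mix[OF f _ \<nu>] by (simp add: t)
    qed
  qed
qed

end
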